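(* Each $0$-series eigenfunction of the Neumann Laplacian on the Vicsek set $\mathcal{VS}_2$ is determined by its restriction to the diagonal: if $u_1$ and $u_2$ are $0$-series eigenfunctions on $\mathcal{VS}_2$ whose restrictions to the diagonal (the segment from $(0,0)$ to $(1,1)$, which is contained in $\mathcal{VS}_2$) coincide, then $u_1=u_2$ on $\mathcal{VS}_2$.
   Context: The Vicsek set $\mathcal{VS}_2$ is the self-similar set generated by $F_1(x)=x/3$, $F_2(x)=x/3+\frac23(1,0)$, $F_3(x)=x/3+\frac23(1,1)$, $F_4(x)=x/3+\frac23(0,1)$, $F_0(x)=x/3+\frac23(\frac12,\frac12)$. $V_0$ is the set of corners of the unit square, $V_m=\bigcup_iF_i(V_{m-1})$. $\Gamma_m$ is the graph on $V_m$ in which two distinct vertices are adjacent iff both lie in $F_w(V_0)$ for some word $w$ of length $m$, where $F_w=F_{w_1}\circ\cdots\circ F_{w_m}$. The graph Laplacian, with Neumann conditions, is $\Delta_mu(x)=\frac1{\deg x}\sum_{y\sim x}(u(y)-u(x))$ for all $x\in V_m$. The Neumann Laplacian is $\Delta u=\lim_m15^m\Delta_mu$; eigenfunctions are continuous nonzero functions with $-\Delta u=\lambda u$. Spectral decimation (known description of the spectrum): let $R(\lambda)=36\lambda^3-48\lambda^2+15\lambda$ and let $\phi_1<\phi_2<\phi_3$ be its inverse branches on $[0,4/3]$. The spectrum is the disjoint union of the $0$-series and the $4/3$-series. The $0$-series eigenvalues are $\lim_{m\to\infty}15^m\phi_{w_m}\circ\cdots\circ\phi_{w_1}(0)$, where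 all but finitely many $w_j$ equal $1$ and the first $w_j\ne1$ (if any) equals $3$; each has multiplicity $1$, and its eigenfunction $u$ (unique up to scaling) satisfies $-\Delta_mu=\phi_{w_m}\circ\cdots\circ\phi_{w_1}(0)\,u$ on $V_m$ for every $m$ (in particular it is constant and nonzero on $V_0$). A $0$-series eigenfunction is an eigenfunction whose eigenvalue is in the $0$-series. The $4/3$-series eigenvalues are $\lim_{m\to\infty}15^{m+k}\phi_{w_m}\circ\cdots\circ\phi_{w_1}(4/3)$ with $k\ge0$, $w_1=1$ and all but finitely many $w_j=1$. *)

theory Defs
  imports "HOL-Analysis.Analysis"
begin

section \<open>The Vicsek set\<close>

definition fmap :: "nat \<Rightarrow> real \<times> real \<Rightarrow> real \<times> real" where
  "fmap i x = (1/3) *\<^sub>R x + (2/3) *\<^sub>R ([(1/2, 1/2), (0, 0), (1, 0), (1, 1), (0, 1)] ! i)"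

definition self_similar_set :: "(real \<times> real) set \<Rightarrow> bool" where
  "self_similar_set K \<longleftrightarrow> compact K \<and> K \<noteq> {} \<and> K = (\<Union>i<5. fmap i ` K)"

text \<open>That exactly one such set exists is proved below (\<open>self_similar_set_vicsek\<close>,
  \<open>self_similar_set_unique\<close>).\<close>

definition vicsek :: "(real \<times> real) set" where
  "vicsek = (THE K. self_similar_set K)"

abbreviation diagonal :: "(real \<times> real) set" where
  "diagonal \<equiv> closed_segment (0, 0) (1, 1)"


section \<open>Approximating graphs and the Neumann Laplacian\<close>

fun V :: "nat \<Rightarrow> (real \<times> real) set" where
  "V 0 = {(0, 0), (1, 0), (1, 1), (0, 1)}"
| "V (Suc m) = (\<Union>i<5. fmap i ` V m)"

definition fword :: "nat list \<Rightarrow> real \<times> real \<Rightarrow> real \<times> real" where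
  "fword w = foldr fmap w"

definition adj :: "nat \<Rightarrow> real \<times> real \<Rightarrow> real \<times> real \<Rightarrow> bool" where
  "adj m x y \<longleftrightarrow> x \<noteq> y \<and>
     (\<exists>w. length w = m \<and> set w \<subseteq> {..<5} \<and> x \<in> fword w ` V 0 \<and> y \<in> fword w ` V 0)"

definition deg :: "nat \<Rightarrow> real \<times> real \<Rightarrow> nat" where
  "deg m x = card {y. adj m x y}"

definition graph_laplacian :: "nat \<Rightarrow> (real \<times> real \<Rightarrow> real) \<Rightarrow> real \<times> real \<Rightarrow> real" where
  "graph_laplacian m u x = (1 / real (deg m x)) * (\<Sum>y | adj m x y. u y - u x)"

text \<open>The limit defining \<open>\<Delta> u = f\<close> is uniform over the vertices, as is standard for
  Laplacians on self-similar fractals, and Neumann conditions mean that the four corners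
  \<open>V 0\<close> are included. A limit at each vertex separately would not do:
  it is blind to kinks at non-vertex points, so that a function that is constant near each corner
  and otherwise harmonic except for such kinks would have Laplacian 0.\<close>

definition has_neumann_laplacian ::
    "(real \<times> real \<Rightarrow> real) \<Rightarrow> (real \<times> real \<Rightarrow> real) \<Rightarrow> bool" where
  "has_neumann_laplacian u f \<longleftrightarrow>
     continuous_on vicsek u \<and> continuous_on vicsek f \<and>
     (\<forall>e>0. \<forall>\<^sub>F m in sequentially. \<forall>x\<in>V m. dist (15 ^ m * graph_laplacian m u x) (f x) < e)"

definition neumann_eigenfunction :: "real \<Rightarrow> (real \<times> real \<Rightarrow> real) \<Rightarrow> bool" where
  "neumann_eigenfunction l u \<longleftrightarrow>
     has_neumann_laplacian u (\<lambda>x. - (l * u x)) \<and> (\<exists>x\<in>vicsek. u x \<noteq> 0)"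


section \<open>The 0-series\<close>

definition decimation_R :: "real \<Rightarrow> real" where
  "decimation_R x = 36 * x ^ 3 - 48 * x\<^sup>2 + 15 * x"

text \<open>For \<open>0 \<le> t \<le> 4/3\<close> the equation \<open>decimation_R x = t\<close> has three distinct real solutions, and
  \<open>phi 1 t < phi 2 t < phi 3 t\<close> are these solutions.\<close>

definition phi :: "nat \<Rightarrow> real \<Rightarrow> real" where
  "phi j t = sorted_list_of_set {x. decimation_R x = t} ! (j - 1)"

text \<open>\<open>phi_comp w m\<close> is the composition of \<open>phi (w m), \<dots>, phi (w 1)\<close>, where \<open>phi (w 1)\<close> is applied
  first; \<open>w 0\<close> is never used.\<close>

fun phi_comp :: "(nat \<Rightarrow> nat) \<Rightarrow> nat \<Rightarrow> real \<Rightarrow> real" where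
  "phi_comp w 0 t = t"
| "phi_comp w (Suc m) t = phi (w (Suc m)) (phi_comp w m t)"

definition zero_series_eigenvalue :: "real \<Rightarrow> bool" where
  "zero_series_eigenvalue l \<longleftrightarrow>
     (\<exists>w. (\<forall>j\<ge>1. w j \<in> {1, 2, 3}) \<and>
          finite {j. j \<ge> 1 \<and> w j \<noteq> 1} \<and>
          (\<forall>j\<ge>1. w j \<noteq> 1 \<and> (\<forall>i\<in>{1..<j}. w i = 1) \<longrightarrow> w j = 3) \<and>
          (\<lambda>m. 15 ^ m * phi_comp w m 0) \<longlonglongrightarrow> l)"

definition zero_series_eigenfunction :: "(real \<times> real \<Rightarrow> real) \<Rightarrow> bool" where
  "zero_series_eigenfunction u \<longleftrightarrow>
     (\<exists>l. zero_series_eigenvalue l \<and> neumann_eigenfunction l u)"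


section \<open>The Vicsek set is well defined and contains the diagonal\<close>

lemma fmap_altdef:
  "fmap i = (\<lambda>x. (2/3) *\<^sub>R ([(1/2, 1/2), (0, 0), (1, 0), (1, 1), (0, 1)] ! i) + x)
            \<circ> (\<lambda>x. (1/3) *\<^sub>R x)"
  by (auto simp: fmap_def fun_eq_iff)

lemma dist_fmap: "dist (fmap i x) (fmap i y) = dist x y / 3"
proof -
  have "fmap i x - fmap i y = (1/3) *\<^sub>R (x - y)"
    by (simp add: fmap_def algebra_simps)
  thus ?thesis by (simp add: dist_norm)
qed

lemma closure_fmap_image: "closure (fmap i ` S) = fmap i ` closure S"
  unfolding fmap_altdef image_comp [symmetric] closure_translation
  using closure_scaleR [of "1/3" S] by simp

lemma lessThan_5: "{..<5::nat} = {0, 1, 2, 3, 4}"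
  by auto

lemma subset_invariant:
  assumes S: "compact S" "S \<subseteq> (\<Union>i<5. fmap i ` S)"
    and K: "closed K" "K \<noteq> {}" "(\<Union>i<5. fmap i ` K) \<subseteq> K"
  shows "S \<subseteq> K"
proof (cases "S = {}")
  case False
  have "continuous_on S (\<lambda>x. infdist x K)"
    by (intro continuous_intros)
  then obtain x where x: "x \<in> S" "\<And>y. y \<in> S \<Longrightarrow> infdist y K \<le> infdist x K"
    using continuous_attains_sup [OF S(1) False] by blast
  obtain i y where y: "i < 5" "y \<in> S" "x = fmap i y"
    using S(2) x(1) by blast
  obtain z where z: "z \<in> K" "infdist y K = dist y z"
    using infdist_attains_inf [OF K(1,2)] by metis
  have "fmap i z \<in> K"
    using K(3) y(1) z(1) by blast
  hence "infdist x K \<le> dist x (fmap i z)"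
    by (rule infdist_le)
  also have "\<dots> = infdist y K / 3"
    by (simp add: y(3) z(2) dist_fmap)
  also have "\<dots> \<le> infdist x K / 3"
    using x(2) [OF y(2)] by simp
  finally have "infdist x K \<le> 0" by simp
  hence "infdist y K = 0" if "y \<in> S" for y
    using x(2) [OF that] infdist_nonneg [of y K] by linarith
  thus ?thesis
    using in_closed_iff_infdist_zero [OF K(1,2)] by blast
qed auto

lemma self_similar_set_unique:
  assumes "self_similar_set K" "self_similar_set L"
  shows "K = L"
  using assms subset_invariant [of K L] subset_invariant [of L K]
  unfolding self_similar_set_def by (simp add: compact_imp_closed)

lemma V_mono_Suc: "V m \<subseteq> V (Suc m)"
proof (induction m)
  case 0
  show ?case by (auto simp: lessThan_5 fmap_def image_iff)
next
  case (Suc m)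
  hence "(\<Union>i<5. fmap i ` V m) \<subseteq> (\<Union>i<5. fmap i ` V (Suc m))"
    by (intro UN_mono image_mono order_refl)
  thus ?case unfolding V.simps(2) [symmetric] .
qed

lemma V_subset_square: "V m \<subseteq> {0..1} \<times> {0..1}"
proof (induction m)
  case (Suc m)
  show ?case
  proof
    fix p assume "p \<in> V (Suc m)"
    then obtain i q where iq: "i \<in> {..<5}" "q \<in> V m" "p = fmap i q" by auto
    from iq(2) Suc have "q \<in> {0..1} \<times> {0..1}" by blast
    thus "p \<in> {0..1} \<times> {0..1}"
      using iq(1,3) unfolding lessThan_5 by (cases q) (auto simp: fmap_def)
  qed
qed auto

lemma self_similar_set_closure: "self_similar_set (closure (\<Union>m. V m))"
proof -
  let ?W = "\<Union>m. V m"
  have "bounded ({0..1::real} \<times> {0..1::real})"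
    by (intro bounded_Times bounded_closed_interval)
  hence "compact (closure ?W)"
    using V_subset_square bounded_subset compact_closure by (metis UN_least)
  moreover have W: "?W = (\<Union>i<5. fmap i ` ?W)"
  proof
    show "?W \<subseteq> (\<Union>i<5. fmap i ` ?W)"
    proof
      fix x assume "x \<in> ?W"
      then obtain m where "x \<in> V m" by blast
      hence "x \<in> V (Suc m)" using V_mono_Suc by blast
      thus "x \<in> (\<Union>i<5. fmap i ` ?W)" by auto
    qed
    show "(\<Union>i<5. fmap i ` ?W) \<subseteq> ?W"
    proof
      fix x assume "x \<in> (\<Union>i<5. fmap i ` ?W)"
      then obtain m where "x \<in> V (Suc m)" by auto
      thus "x \<in> ?W" by blast
    qed
  qed
  have "closure ?W = (\<Union>i<5. fmap i ` closure ?W)"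
    by (subst W) (simp only: lessThan_5 UN_insert UN_empty closure_Un closure_empty closure_fmap_image)
  moreover have "(0, 0) \<in> V 0" by simp
  hence "closure ?W \<noteq> {}"
    unfolding closure_eq_empty by (metis UN_I UNIV_I empty_iff)
  ultimately show ?thesis
    unfolding self_similar_set_def by (intro conjI)
qed

lemma self_similar_set_vicsek: "self_similar_set vicsek"
  unfolding vicsek_def
  using theI [of self_similar_set, OF self_similar_set_closure self_similar_set_unique [OF _ self_similar_set_closure]] .

lemma diagonal_subset_vicsek: "diagonal \<subseteq> vicsek"
proof (rule subset_invariant)
  have diag: "diagonal = {(t, t) | t. 0 \<le> t \<and> t \<le> 1}"
    by (auto simp: closed_segment_def)
  show "diagonal \<subseteq> (\<Union>i<5. fmap i ` diagonal)"
  proof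
    fix x assume "x \<in> diagonal"
    then obtain t where t: "x = (t, t)" "0 \<le> t" "t \<le> 1" unfolding diag by auto
    consider "t \<le> 1/3" | "1/3 \<le> t" "t \<le> 2/3" | "2/3 \<le> t" by linarith
    then obtain i s where "i \<in> {..<5}" "0 \<le> s" "s \<le> 1" "x = fmap i (s, s)"
    proof cases
      case 1
      thus ?thesis using that [of 1 "3 * t"] t by (simp add: fmap_def)
    next
      case 2
      thus ?thesis using that [of 0 "3 * t - 1"] t by (simp add: fmap_def field_simps)
    next
      case 3
      thus ?thesis using that [of 3 "3 * t - 2"] t
        by (simp add: fmap_def numeral_3_eq_3 field_simps)
    qed
    thus "x \<in> (\<Union>i<5. fmap i ` diagonal)" unfolding diag by blast
  qed
qed (use self_similar_set_vicsek in \<open>auto simp: self_similar_set_def compact_imp_closed\<close>)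

end

theory Submission
  imports Defs
begin

text \<open>Write \<open>\<lambda>\<close> for the eigenvalue on \<open>V m\<close>, \<open>\<mu> = 4 - 3\<lambda>\<close>, and let the residual of \<open>u\<close> at a vertex
  be \<open>deg\<close> times \<open>\<Delta>\<^sub>m u + \<lambda> u\<close>. Eliminating the new vertices of a single cell expresses the residual
  on \<open>V m\<close> for \<open>R \<lambda>\<close> through the residuals on \<open>V (m + 1)\<close> for \<open>\<lambda>\<close>. For \<open>0 \<le> \<lambda> \<le> 1/6\<close> all
  coefficients are nonnegative and their total is at most 15, the scaling factor of the Laplacian.
  Since the scaled residuals of a Neumann eigenfunction tend to 0 uniformly, they vanish exactly at
  all high levels, and then at every level, because only \<open>\<mu> \<noteq> 0\<close> is needed to go down. Going up, a
  solution is determined by its values on \<open>V 0\<close> as long as \<open>\<lambda>\<close> avoids the forbidden values; the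
  value \<open>1/2\<close> is excluded by the condition that the first letter different from 1 is 3.
  Finally, the vertex equations in the cell at the corner \<open>(0, 0)\<close> say that \<open>u (1/3^m, 1/3^m)\<close> is
  \<open>(1 - 3 \<lambda>) u (0, 0)\<close>, so the diagonal determines \<open>\<lambda>\<close> at every level.\<close>

section \<open>Cells, vertex sums and residuals in integer coordinates\<close>

definition grid :: "(real \<times> real \<Rightarrow> real) \<Rightarrow> nat \<Rightarrow> int \<Rightarrow> int \<Rightarrow> real" where
  "grid u m x y = u (of_int x / 3 ^ m, of_int y / 3 ^ m)"

text \<open>In integer coordinates scaled by \<open>3 ^ m\<close>, \<open>cell m a b\<close> says that the unit square with lower left
  corner \<open>(a, b)\<close> is the image of the unit square under \<open>F\<^sub>w\<close> for some word \<open>w\<close> of length \<open>m\<close>. All cells have the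
  same checkerboard colour (\<open>cell_even\<close>), so distinct cells meet in at most one vertex.\<close>

fun cell :: "nat \<Rightarrow> int \<Rightarrow> int \<Rightarrow> bool" where
  "cell 0 a b \<longleftrightarrow> a = 0 \<and> b = 0"
| "cell (Suc m) a b \<longleftrightarrow> cell m (a div 3) (b div 3) \<and>
     (a mod 3, b mod 3) \<in> {(1, 1), (0, 0), (2, 0), (2, 2), (0, 2)}"

text \<open>The four arguments of \<open>f\<close> are the lower left corners of the unit squares
  that contain \<open>(x, y)\<close>. The indicator factors make the sum vanish off the vertex
  set.\<close>

definition around :: "nat \<Rightarrow> (int \<Rightarrow> int \<Rightarrow> real) \<Rightarrow> int \<Rightarrow> int \<Rightarrow> real" where
  "around m f x y =
     of_bool (cell m x y) * f x y + of_bool (cell m (x - 1) y) * f (x - 1) y +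
     of_bool (cell m x (y - 1)) * f x (y - 1) + of_bool (cell m (x - 1) (y - 1)) * f (x - 1) (y - 1)"

definition csum :: "(int \<Rightarrow> int \<Rightarrow> real) \<Rightarrow> int \<Rightarrow> int \<Rightarrow> real" where
  "csum U a b = U a b + U (a + 1) b + U a (b + 1) + U (a + 1) (b + 1)"

text \<open>For \<open>\<mu> = 4 - 3\<lambda>\<close> this is \<open>deg\<close> times \<open>\<Delta>\<^sub>m u + \<lambda> u\<close> (\<open>residual_eq_laplacian\<close>): since a cell is a
  complete graph, it contributes its sum minus four times the value at the vertex.\<close>

definition residual :: "nat \<Rightarrow> real \<Rightarrow> (int \<Rightarrow> int \<Rightarrow> real) \<Rightarrow> int \<Rightarrow> int \<Rightarrow> real" where
  "residual m \<mu> U x y = around m (\<lambda>a b. csum U a b - \<mu> * U x y) x y"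

text \<open>A third of the degree (\<open>deg_scaled\<close>), and 0 off the vertex set, so bounds
  in terms of it can be stated at every integer point.\<close>

abbreviation ncells :: "nat \<Rightarrow> int \<Rightarrow> int \<Rightarrow> real" where
  "ncells m \<equiv> around m (\<lambda>_ _. 1)"

lemma grid_Suc: "grid u (Suc m) (3 * x) (3 * y) = grid u m x y"
  by (simp add: grid_def)

lemma cell_nonneg: "cell m a b \<Longrightarrow> 0 \<le> a \<and> 0 \<le> b"
  by (induction m arbitrary: a b) force+

lemma cell_even: "cell m a b \<Longrightarrow> even (a + b)"
proof (induction m arbitrary: a b)
  case (Suc m)
  hence "even (a div 3 + b div 3)" "even (a mod 3 + b mod 3)" by auto
  moreover have "a + b = 3 * (a div 3 + b div 3) + (a mod 3 + b mod 3)"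
    by (simp add: algebra_simps)
  ultimately show ?case by (metis even_add even_mult_iff)
qed simp

lemma cell_origin: "cell m 0 0"
  by (induction m) auto

lemma cell_SucE:
  assumes "cell (Suc m) a b"
  obtains a' b' where "cell m a' b'"
    "(a, b) \<in> {(3 * a' + 1, 3 * b' + 1), (3 * a', 3 * b'), (3 * a' + 2, 3 * b'),
       (3 * a', 3 * b' + 2), (3 * a' + 2, 3 * b' + 2)}"
proof (rule that [of "a div 3" "b div 3"])
  show "cell m (a div 3) (b div 3)" using assms by simp
  have "(a mod 3, b mod 3) \<in> {(1, 1), (0, 0), (2, 0), (2, 2), (0, 2)}"
    using assms by simp
  thus "(a, b) \<in> {(3 * (a div 3) + 1, 3 * (b div 3) + 1), (3 * (a div 3), 3 * (b div 3)),
       (3 * (a div 3) + 2, 3 * (b div 3)), (3 * (a div 3), 3 * (b div 3) + 2),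
       (3 * (a div 3) + 2, 3 * (b div 3) + 2)}"
    unfolding insert_iff empty_iff prod.inject by presburger
qed

lemma cell_iff_mod:
  assumes "0 \<le> i" "i < 3" "0 \<le> j" "j < 3"
  shows "cell (Suc m) (3 * a + i) (3 * b + j) \<longleftrightarrow>
    cell m a b \<and> (i, j) \<in> {(1, 1), (0, 0), (2, 0), (2, 2), (0, 2)}"
  using assms by simp

text \<open>At an old vertex each cell is replaced by its one corner subcell there, so the number of
  cells is kept.\<close>

lemma around_Suc_vertex:
  "around (Suc m) f (3 * x) (3 * y) =
     of_bool (cell m x y) * f (3 * x) (3 * y) +
     of_bool (cell m (x - 1) y) * f (3 * (x - 1) + 2) (3 * y) +
     of_bool (cell m x (y - 1)) * f (3 * x) (3 * (y - 1) + 2) +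
     of_bool (cell m (x - 1) (y - 1)) * f (3 * (x - 1) + 2) (3 * (y - 1) + 2)"
proof -
  have *: "3 * x - 1 = 3 * (x - 1) + 2" "3 * y - 1 = 3 * (y - 1) + 2" by simp_all
  have "cell (Suc m) (3 * x) (3 * y) = cell m x y"
    "cell (Suc m) (3 * (x - 1) + 2) (3 * y) = cell m (x - 1) y"
    "cell (Suc m) (3 * x) (3 * (y - 1) + 2) = cell m x (y - 1)"
    "cell (Suc m) (3 * (x - 1) + 2) (3 * (y - 1) + 2) = cell m (x - 1) (y - 1)"
    using cell_iff_mod [of 0 0 m x y] cell_iff_mod [of 2 0 m "x - 1" y]
      cell_iff_mod [of 0 2 m x "y - 1"] cell_iff_mod [of 2 2 m "x - 1" "y - 1"]
    by (simp_all del: cell.simps)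
  thus ?thesis unfolding around_def * by (simp del: cell.simps)
qed

text \<open>A junction is a corner of the central subcell and of exactly one corner subcell.\<close>

lemma around_junction:
  assumes "cell m a b"
  shows "around (Suc m) f (3 * a + 1) (3 * b + 1) = f (3 * a) (3 * b) + f (3 * a + 1) (3 * b + 1)"
    and "around (Suc m) f (3 * a + 2) (3 * b + 1) = f (3 * a + 2) (3 * b) + f (3 * a + 1) (3 * b + 1)"
    and "around (Suc m) f (3 * a + 1) (3 * b + 2) = f (3 * a) (3 * b + 2) + f (3 * a + 1) (3 * b + 1)"
    and "around (Suc m) f (3 * a + 2) (3 * b + 2) = f (3 * a + 2) (3 * b + 2) + f (3 * a + 1) (3 * b + 1)"
  using assms by (simp_all add: around_def add_ac)

text \<open>The points lie on the edges of the cell. The only other subcell that could contain such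
  a point belongs to the cell across that edge, which has the wrong colour by
  \<open>cell_even\<close>.\<close>

lemma around_dead_end:
  assumes "cell m a b"
  shows "around (Suc m) f (3 * a + 1) (3 * b) = f (3 * a) (3 * b)"
    and "around (Suc m) f (3 * a) (3 * b + 1) = f (3 * a) (3 * b)"
    and "around (Suc m) f (3 * a + 2) (3 * b) = f (3 * a + 2) (3 * b)"
    and "around (Suc m) f (3 * a + 3) (3 * b + 1) = f (3 * a + 2) (3 * b)"
    and "around (Suc m) f (3 * a) (3 * b + 2) = f (3 * a) (3 * b + 2)"
    and "around (Suc m) f (3 * a + 1) (3 * b + 3) = f (3 * a) (3 * b + 2)"
    and "around (Suc m) f (3 * a + 3) (3 * b + 2) = f (3 * a + 2) (3 * b + 2)"
    and "around (Suc m) f (3 * a + 2) (3 * b + 3) = f (3 * a + 2) (3 * b + 2)"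
proof -
  have odd: "\<not> cell m (a + 1) b" "\<not> cell m (a - 1) b" "\<not> cell m a (b + 1)" "\<not> cell m a (b - 1)"
    using cell_even [of m] cell_even [OF assms] by fastforce+
  have *: "(3 * c - 1) div 3 = c - 1" "(3 * c - 1) mod 3 = 2" "(3 * c + 3) div 3 = c + 1"
    "(3 * c + 3) mod 3 = 0" for c :: int
    by presburger+
  show "around (Suc m) f (3 * a + 1) (3 * b) = f (3 * a) (3 * b)"
    "around (Suc m) f (3 * a) (3 * b + 1) = f (3 * a) (3 * b)"
    "around (Suc m) f (3 * a + 2) (3 * b) = f (3 * a + 2) (3 * b)"
    "around (Suc m) f (3 * a + 3) (3 * b + 1) = f (3 * a + 2) (3 * b)"
    "around (Suc m) f (3 * a) (3 * b + 2) = f (3 * a) (3 * b + 2)"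
    "around (Suc m) f (3 * a + 1) (3 * b + 3) = f (3 * a) (3 * b + 2)"
    "around (Suc m) f (3 * a + 3) (3 * b + 2) = f (3 * a + 2) (3 * b + 2)"
    "around (Suc m) f (3 * a + 2) (3 * b + 3) = f (3 * a + 2) (3 * b + 2)"
    using assms odd by (simp_all add: around_def * add_ac)
qed

section \<open>The approximating graphs in integer coordinates\<close>

text \<open>The induction peels off the last letter: it is the innermost map, hence it picks the
  subcell, which is the lowest ternary digit split off by \<open>cell\<close>.\<close>

lemma fword_cell:
  assumes "length w = m" "set w \<subseteq> {..<5}"
  shows "\<exists>a b. cell m a b \<and>
    (\<forall>x y. fword w (x, y) = ((of_int a + x) / 3 ^ m, (of_int b + y) / 3 ^ m))"
  using assms
proof (induction m arbitrary: w)
  case 0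
  thus ?case by (auto simp: fword_def)
next
  case (Suc m)
  then obtain w' i where w: "w = w' @ [i]" "length w' = m"
    by (metis length_Suc_conv_rev)
  with Suc.prems have i: "i \<in> {..<5}" and w': "set w' \<subseteq> {..<5}" by auto
  obtain a b where ab: "cell m a b"
    "\<And>x y. fword w' (x, y) = ((of_int a + x) / 3 ^ m, (of_int b + y) / 3 ^ m)"
    using Suc.IH [OF w(2) w'] by blast
  have fw: "fword w (x, y) = fword w' (fmap i (x, y))" for x y
    by (simp add: w fword_def)
  define c d where "c = [1, 0, 2, 2, 0 :: int] ! i" and "d = [1, 0, 0, 2, 2 :: int] ! i"
  have "cell (Suc m) (3 * a + c) (3 * b + d)"
    using i ab(1) unfolding lessThan_5 c_def d_def by auto
  moreover have "fmap i (x, y) = ((of_int c + x) / 3, (of_int d + y) / 3)" for x y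
    using i unfolding lessThan_5 by (auto simp: fmap_def c_def d_def add_divide_distrib)
  hence "fword w (x, y) = ((of_int (3 * a + c) + x) / 3 ^ Suc m, (of_int (3 * b + d) + y) / 3 ^ Suc m)"
    for x y by (simp add: fw ab(2) field_simps)
  ultimately show ?case by blast
qed

lemma cell_fword:
  assumes "cell m a b"
  shows "\<exists>w. length w = m \<and> set w \<subseteq> {..<5} \<and>
    (\<forall>x y. fword w (x, y) = ((of_int a + x) / 3 ^ m, (of_int b + y) / 3 ^ m))"
  using assms
proof (induction m arbitrary: a b)
  case 0
  thus ?case by (auto simp: fword_def)
next
  case (Suc m)
  obtain a' b' where ab: "cell m a' b'"
    "(a, b) \<in> {(3 * a' + 1, 3 * b' + 1), (3 * a', 3 * b'), (3 * a' + 2, 3 * b'),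
       (3 * a', 3 * b' + 2), (3 * a' + 2, 3 * b' + 2)}"
    using cell_SucE [OF Suc.prems] .
  obtain w where w: "length w = m" "set w \<subseteq> {..<5}"
    "\<And>x y. fword w (x, y) = ((of_int a' + x) / 3 ^ m, (of_int b' + y) / 3 ^ m)"
    using Suc.IH [OF ab(1)] by blast
  define c d where "c = a - 3 * a'" and "d = b - 3 * b'"
  have "\<exists>i<5. \<forall>x y. fmap i (x, y) = ((of_int c + x) / 3, (of_int d + y) / 3)"
  proof -
    have "(c, d) \<in> {(1, 1), (0, 0), (2, 0), (2, 2), (0, 2)}"
      using ab(2) by (auto simp: c_def d_def)
    hence "\<exists>i\<in>{..<5}. (c, d) = [(1, 1), (0, 0), (2, 0), (2, 2), (0, 2)] ! i"
      unfolding lessThan_5 by auto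
    then obtain i where "i \<in> {..<5}" "(c, d) = [(1, 1), (0, 0), (2, 0), (2, 2), (0, 2)] ! i"
      by blast
    moreover from this
    have "\<forall>x y. fmap i (x, y) = ((of_int c + x) / 3, (of_int d + y) / 3)"
      unfolding lessThan_5 by (auto simp: fmap_def add_divide_distrib)
    ultimately show ?thesis by blast
  qed
  then obtain i where i: "i < 5" "\<And>x y. fmap i (x, y) = ((of_int c + x) / 3, (of_int d + y) / 3)"
    by blast
  have "fword (w @ [i]) (x, y) = fword w (fmap i (x, y))" for x y
    by (simp add: fword_def)
  hence "fword (w @ [i]) (x, y) = ((of_int a + x) / 3 ^ Suc m, (of_int b + y) / 3 ^ Suc m)" for x y
    by (simp add: i w(3) c_def d_def field_simps)
  thus ?case using w i(1) by (intro exI [of _ "w @ [i]"]) auto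
qed

text \<open>\<open>V\<close> prepends letters while \<open>cell\<close> appends digits; words
  mediate between the two recursions.\<close>

lemma V_eq_fword: "V m = (\<Union>w\<in>{w. length w = m \<and> set w \<subseteq> {..<5}}. fword w ` V 0)"
proof (induction m)
  case 0
  show ?case by (auto simp: fword_def)
next
  case (Suc m)
  have "V (Suc m) = (\<Union>i<5. \<Union>w\<in>{w. length w = m \<and> set w \<subseteq> {..<5}}. fword (i # w) ` V 0)"
    unfolding V.simps(2) Suc.IH by (simp add: image_UN image_image fword_def del: V.simps)
  also have "\<dots> = (\<Union>w\<in>{w. length w = Suc m \<and> set w \<subseteq> {..<5}}. fword w ` V 0)"
    by (fastforce simp: length_Suc_conv simp del: V.simps)
  finally show ?case .
qed

definition corner :: "int \<Rightarrow> int \<Rightarrow> int \<Rightarrow> int \<Rightarrow> bool" where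
  "corner a b x y \<longleftrightarrow> (x, y) \<in> {(a, b), (a + 1, b), (a + 1, b + 1), (a, b + 1)}"

definition scaled :: "nat \<Rightarrow> int \<Rightarrow> int \<Rightarrow> real \<times> real" where
  "scaled m x y = (of_int x / 3 ^ m, of_int y / 3 ^ m)"

lemma scaled_eq_iff [simp]: "scaled m x y = scaled m x' y' \<longleftrightarrow> x = x' \<and> y = y'"
  by (simp add: scaled_def)

lemma fword_image:
  assumes "\<And>x y. fword w (x, y) = ((of_int a + x) / 3 ^ m, (of_int b + y) / 3 ^ m)"
  shows "p \<in> fword w ` V 0 \<longleftrightarrow> (\<exists>x y. corner a b x y \<and> p = scaled m x y)"
proof -
  have "fword w ` V 0 =
    {scaled m a b, scaled m (a + 1) b, scaled m (a + 1) (b + 1), scaled m a (b + 1)}"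
    by (simp add: assms scaled_def add.commute)
  thus ?thesis unfolding corner_def by auto
qed

text \<open>Stated for an arbitrary predicate \<open>P\<close> on vertex sets, so that membership in
  \<open>V\<close> and adjacency are both instances.\<close>

lemma word_cell_ex:
  "(\<exists>w. length w = m \<and> set w \<subseteq> {..<5} \<and> P (fword w ` V 0)) \<longleftrightarrow>
   (\<exists>a b. cell m a b \<and> P {scaled m x y | x y. corner a b x y})"
proof
  assume "\<exists>w. length w = m \<and> set w \<subseteq> {..<5} \<and> P (fword w ` V 0)"
  then obtain w where w: "length w = m" "set w \<subseteq> {..<5}" "P (fword w ` V 0)" by blast
  obtain a b where ab: "cell m a b"
    "\<And>x y. fword w (x, y) = ((of_int a + x) / 3 ^ m, (of_int b + y) / 3 ^ m)"
    using fword_cell [OF w(1,2)] by blast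
  have "fword w ` V 0 = {scaled m x y | x y. corner a b x y}"
    using fword_image [OF ab(2)] by blast
  thus "\<exists>a b. cell m a b \<and> P {scaled m x y | x y. corner a b x y}"
    using w(3) ab(1) by auto
next
  assume "\<exists>a b. cell m a b \<and> P {scaled m x y | x y. corner a b x y}"
  then obtain a b where ab: "cell m a b" "P {scaled m x y | x y. corner a b x y}" by blast
  obtain w where w: "length w = m" "set w \<subseteq> {..<5}"
    "\<And>x y. fword w (x, y) = ((of_int a + x) / 3 ^ m, (of_int b + y) / 3 ^ m)"
    using cell_fword [OF ab(1)] by blast
  have "fword w ` V 0 = {scaled m x y | x y. corner a b x y}"
    using fword_image [OF w(3)] by blast
  thus "\<exists>w. length w = m \<and> set w \<subseteq> {..<5} \<and> P (fword w ` V 0)"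
    using w(1,2) ab(2) by auto
qed

lemma V_iff_corner: "p \<in> V m \<longleftrightarrow> (\<exists>a b x y. cell m a b \<and> corner a b x y \<and> p = scaled m x y)"
  using word_cell_ex [of m "\<lambda>S. p \<in> S"] by (subst V_eq_fword) auto

lemma adj_iff_corner:
  "adj m (scaled m x y) q \<longleftrightarrow> (\<exists>a b x' y'. cell m a b \<and> corner a b x y \<and> corner a b x' y' \<and>
     (x', y') \<noteq> (x, y) \<and> q = scaled m x' y')"
  unfolding adj_def word_cell_ex [of m "\<lambda>S. scaled m x y \<in> S \<and> q \<in> S"] by auto

lemma neighbours_corner:
  "{q. adj m (scaled m x y) q} = (\<lambda>(x, y). scaled m x y) `
    {(x', y'). \<exists>a b. cell m a b \<and> corner a b x y \<and> corner a b x' y' \<and> (x', y') \<noteq> (x, y)}"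
  by (simp add: set_eq_iff image_iff adj_iff_corner Bex_def) blast

lemma cell_corner_ex:
  "(\<exists>a b. cell m a b \<and> corner a b x y \<and> P a b) \<longleftrightarrow>
     (cell m x y \<and> P x y) \<or> (cell m (x - 1) y \<and> P (x - 1) y) \<or>
     (cell m x (y - 1) \<and> P x (y - 1)) \<or> (cell m (x - 1) (y - 1) \<and> P (x - 1) (y - 1))"
proof -
  have "corner a b x y \<longleftrightarrow> (a, b) \<in> {(x, y), (x - 1, y), (x - 1, y - 1), (x, y - 1)}" for a b
    by (auto simp: corner_def)
  thus ?thesis by auto
qed

text \<open>By \<open>cell_even\<close> only the cells to the upper right and to the lower left can
  contain a vertex of even coordinate sum. They share no further vertex, so neighbours are listed
  without repetition.\<close>

lemma neighbours_even:
  assumes "even (x + y)"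
  shows "{q. adj m (scaled m x y) q} = (\<lambda>(x, y). scaled m x y) `
    ((if cell m x y then {(x + 1, y), (x, y + 1), (x + 1, y + 1)} else {}) \<union>
     (if cell m (x - 1) (y - 1) then {(x - 1, y), (x, y - 1), (x - 1, y - 1)} else {}))"
proof -
  have no: "\<not> cell m (x - 1) y" "\<not> cell m x (y - 1)"
    using assms cell_even [of m] by fastforce+
  have "{(x', y'). \<exists>a b. cell m a b \<and> corner a b x y \<and> corner a b x' y' \<and> (x', y') \<noteq> (x, y)} =
    (if cell m x y then {(x + 1, y), (x, y + 1), (x + 1, y + 1)} else {}) \<union>
     (if cell m (x - 1) (y - 1) then {(x - 1, y), (x, y - 1), (x - 1, y - 1)} else {})"
    unfolding cell_corner_ex using no by (auto simp: corner_def)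
  thus ?thesis unfolding neighbours_corner by simp
qed

lemma neighbours_odd:
  assumes "odd (x + y)"
  shows "{q. adj m (scaled m x y) q} = (\<lambda>(x, y). scaled m x y) `
    ((if cell m (x - 1) y then {(x - 1, y), (x - 1, y + 1), (x, y + 1)} else {}) \<union>
     (if cell m x (y - 1) then {(x, y - 1), (x + 1, y - 1), (x + 1, y)} else {}))"
proof -
  have no: "\<not> cell m x y" "\<not> cell m (x - 1) (y - 1)"
    using assms cell_even [of m] by fastforce+
  have "{(x', y'). \<exists>a b. cell m a b \<and> corner a b x y \<and> corner a b x' y' \<and> (x', y') \<noteq> (x, y)} =
    (if cell m (x - 1) y then {(x - 1, y), (x - 1, y + 1), (x, y + 1)} else {}) \<union>
     (if cell m x (y - 1) then {(x, y - 1), (x + 1, y - 1), (x + 1, y)} else {})"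
    unfolding cell_corner_ex using no by (auto simp: corner_def)
  thus ?thesis unfolding neighbours_corner by simp
qed

section \<open>Degrees and the graph Laplacian in terms of cells\<close>

lemma inj_scaled: "inj_on (\<lambda>(x, y). scaled m x y) A"
  by (auto simp: inj_on_def)

lemma deg_scaled: "real (deg m (scaled m x y)) = 3 * ncells m x y"
proof (cases "even (x + y)")
  case True
  hence no: "\<not> cell m (x - 1) y" "\<not> cell m x (y - 1)"
    using cell_even [of m] by fastforce+
  show ?thesis unfolding deg_def neighbours_even [OF True] card_image [OF inj_scaled]
    using no by (simp add: around_def)
next
  case False
  hence no: "\<not> cell m x y" "\<not> cell m (x - 1) (y - 1)"
    using cell_even [of m] by fastforce+
  show ?thesis unfolding deg_def neighbours_odd [OF False] card_image [OF inj_scaled]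
    using no by (simp add: around_def)
qed

lemma residual_eq_sum:
  "residual m (4 - 3 * t) (grid u m) x y =
     (\<Sum>q | adj m (scaled m x y) q. u q - u (scaled m x y)) + 3 * ncells m x y * t * u (scaled m x y)"
proof (cases "even (x + y)")
  case True
  hence no: "\<not> cell m (x - 1) y" "\<not> cell m x (y - 1)"
    using cell_even [of m] by fastforce+
  show ?thesis unfolding neighbours_even [OF True] sum.reindex [OF inj_scaled]
    using no by (simp add: around_def residual_def csum_def grid_def scaled_def algebra_simps)
next
  case False
  hence no: "\<not> cell m x y" "\<not> cell m (x - 1) (y - 1)"
    using cell_even [of m] by fastforce+
  show ?thesis unfolding neighbours_odd [OF False] sum.reindex [OF inj_scaled]
    using no by (simp add: around_def residual_def csum_def grid_def scaled_def algebra_simps)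
qed

lemma residual_eq_laplacian:
  "residual m (4 - 3 * t) (grid u m) x y =
     3 * ncells m x y * (graph_laplacian m u (scaled m x y) + t * u (scaled m x y))"
\<comment> \<open>Off the vertex set both sides are 0; otherwise the degree is nonzero and
  cancels.\<close>
proof (cases "ncells m x y = 0")
  case True
  hence "\<not> cell m x y" "\<not> cell m (x - 1) y" "\<not> cell m x (y - 1)" "\<not> cell m (x - 1) (y - 1)"
    by (auto simp: around_def of_bool_def split: if_splits)
  thus ?thesis by (simp add: residual_def around_def)
next
  case False
  thus ?thesis
    unfolding residual_eq_sum graph_laplacian_def deg_scaled by (simp add: field_simps)
qed

section \<open>Spectral decimation on a single cell\<close>

abbreviation residual_denom :: "real \<Rightarrow> real" where
  "residual_denom \<mu> \<equiv> 2 * \<mu>\<^sup>2 - 9 * \<mu> + 8"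

text \<open>\<open>x\<^sub>i\<close> are the corner values of a cell, \<open>z\<^sub>i\<close> the junctions with its central subcell, \<open>d\<^sub>i\<close> the sums
  over the two dead ends of the corner subcells; \<open>S\<^sub>i\<close> and \<open>S\<^sub>0\<close> are the sums over the subcells.\<close>

lemma cell_elimination:
  fixes \<mu> :: real
  assumes S: "S1 = x1 + d1 + z1" "S2 = x2 + d2 + z2"
      "S3 = x3 + d3 + z3" "S4 = x4 + d4 + z4" "S0 = z1 + z2 + z3 + z4"
    and e: "e1 = 2 * S1 - \<mu> * d1" "e2 = 2 * S2 - \<mu> * d2"
      "e3 = 2 * S3 - \<mu> * d3" "e4 = 2 * S4 - \<mu> * d4"
    and r: "r1 = S1 + S0 - 2 * \<mu> * z1" "r2 = S2 + S0 - 2 * \<mu> * z2"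
      "r3 = S3 + S0 - 2 * \<mu> * z3" "r4 = S4 + S0 - 2 * \<mu> * z4"
  shows "\<mu> * (x1 + x2 + x3 + x4 - residual_denom \<mu> * (2 * \<mu> - 7) * x1) =
    residual_denom \<mu> * (2 * \<mu> - 5) * (S1 - \<mu> * x1) + (residual_denom \<mu> * (2 * e1 + r1) +
      (e1 + e2 + e3 + e4) + (\<mu> - 2) * (r1 + r2 + r3 + r4))"
  \<comment> \<open>The identity comes from two eliminations. The first subcell gives
    \<open>(2 * \<mu> - 5) * S1 = 2 * \<mu> * x1 + S0 - 2 * e1 - r1\<close>. Summing this over the
    four subcells and using \<open>S0\<close> gives \<open>residual_denom \<mu> * S0 = \<mu> * (x1 +
    x2 + x3 + x4) - (e1 + e2 + e3 + e4) - (\<mu> - 2) * (r1 + r2 + r3 + r4)\<close>. Then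
    \<open>S0\<close> is eliminated.\<close>
  unfolding r e S by (simp add: power2_eq_square algebra_simps)

text \<open>The same elimination with zero corners and zero residuals: every \<open>Si\<close>
  satisfies \<open>(2 * \<mu> - 5) * Si = S0\<close>, and
  \<open>residual_denom \<mu> * S0 = 0\<close>. The two dead ends are kept apart because each has to
  vanish.\<close>

lemma cell_extension_zero:
  fixes \<mu> :: real
  assumes S: "S1 = d1 + d1' + z1" "S2 = d2 + d2' + z2"
      "S3 = d3 + d3' + z3" "S4 = d4 + d4' + z4" "S0 = z1 + z2 + z3 + z4"
    and e: "S1 - \<mu> * d1 = 0" "S1 - \<mu> * d1' = 0" "S2 - \<mu> * d2 = 0" "S2 - \<mu> * d2' = 0"
      "S3 - \<mu> * d3 = 0" "S3 - \<mu> * d3' = 0" "S4 - \<mu> * d4 = 0" "S4 - \<mu> * d4' = 0"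
    and r: "S1 + S0 - 2 * \<mu> * z1 = 0" "S2 + S0 - 2 * \<mu> * z2 = 0"
      "S3 + S0 - 2 * \<mu> * z3 = 0" "S4 + S0 - 2 * \<mu> * z4 = 0"
    and \<mu>: "\<mu> \<noteq> 0" "residual_denom \<mu> \<noteq> 0" "2 * \<mu> - 5 \<noteq> 0"
  shows "d1 = 0 \<and> d1' = 0 \<and> z1 = 0"
proof -
  have elim: "(2 * \<mu> - 5) * T = 2 * \<mu> * z0 - T"
    if "T = d + d' + z0" "T - \<mu> * d = 0" "T - \<mu> * d' = 0" for T d d' z0 :: real
  proof -
    have "\<mu> * T = \<mu> * d + \<mu> * d' + \<mu> * z0"
      by (subst that(1)) (simp add: algebra_simps)
    moreover have "(2 * \<mu> - 5) * T = 2 * (\<mu> * T) - 5 * T" by (simp add: algebra_simps)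
    ultimately show ?thesis using that(2,3) by linarith
  qed
  have T: "(2 * \<mu> - 5) * S1 = S0" "(2 * \<mu> - 5) * S2 = S0"
    "(2 * \<mu> - 5) * S3 = S0" "(2 * \<mu> - 5) * S4 = S0"
    using elim [OF S(1) e(1,2)] elim [OF S(2) e(3,4)] elim [OF S(3) e(5,6)] elim [OF S(4) e(7,8)] r
    by linarith+
  have "2 * \<mu> * S0 = (S1 + S2 + S3 + S4) + 4 * S0"
    unfolding S(5) using r unfolding S(5) by (simp add: algebra_simps)
  hence "(2 * \<mu> - 5) * (2 * \<mu> * S0) = (2 * \<mu> - 5) * S1 + (2 * \<mu> - 5) * S2 +
      (2 * \<mu> - 5) * S3 + (2 * \<mu> - 5) * S4 + 4 * (2 * \<mu> - 5) * S0"
    by (simp add: algebra_simps)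
  hence "2 * (residual_denom \<mu> * S0) = 0"
    unfolding T by (simp add: power2_eq_square algebra_simps)
  hence S0: "S0 = 0" using \<mu> by simp
  hence "S1 = 0" using T \<mu> by simp
  thus ?thesis using S0 e(1,2) r(1) \<mu> by simp
qed

text \<open>This is the decimation cubic in the variable \<mu> = 4 - 3t, matching the coefficient
  produced by \<open>cell_elimination\<close>.\<close>

lemma decimation_R_denom:
  "4 - 3 * decimation_R t = residual_denom (4 - 3 * t) * (2 * (4 - 3 * t) - 7)"
  by (simp add: decimation_R_def power2_eq_square power3_eq_cube algebra_simps)

section \<open>Residuals on consecutive levels\<close>

text \<open>\<open>i, j \<in> {0, 1}\<close> select the corner \<open>(a + i, b + j)\<close> of the cell \<open>(a, b)\<close>.\<close>

definition dead_ends :: "(int \<Rightarrow> int \<Rightarrow> real) \<Rightarrow> int \<Rightarrow> int \<Rightarrow> int \<Rightarrow> int \<Rightarrow> real" where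
  "dead_ends r a b i j = r (3 * a + 3 * i) (3 * b + 1 + j) + r (3 * a + 1 + i) (3 * b + 3 * j)"

definition junction :: "(int \<Rightarrow> int \<Rightarrow> real) \<Rightarrow> int \<Rightarrow> int \<Rightarrow> int \<Rightarrow> int \<Rightarrow> real" where
  "junction r a b i j = r (3 * a + 1 + i) (3 * b + 1 + j)"

text \<open>The inhomogeneous part of \<open>cell_elimination\<close>, for the corner selected by
  \<open>i\<close> and \<open>j\<close>.\<close>

definition correction :: "real \<Rightarrow> (int \<Rightarrow> int \<Rightarrow> real) \<Rightarrow> int \<Rightarrow> int \<Rightarrow> int \<Rightarrow> int \<Rightarrow> real" where
  "correction \<mu> r a b i j =
     residual_denom \<mu> * (2 * dead_ends r a b i j + junction r a b i j) +
     (dead_ends r a b 0 0 + dead_ends r a b 1 0 + dead_ends r a b 0 1 + dead_ends r a b 1 1) +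
     (\<mu> - 2) * (junction r a b 0 0 + junction r a b 1 0 + junction r a b 0 1 + junction r a b 1 1)"

lemma residual_dead_end:
  assumes "cell m a b"
  shows "residual (Suc m) \<mu> U (3 * a + 1) (3 * b) = csum U (3 * a) (3 * b) - \<mu> * U (3 * a + 1) (3 * b)"
    and "residual (Suc m) \<mu> U (3 * a) (3 * b + 1) = csum U (3 * a) (3 * b) - \<mu> * U (3 * a) (3 * b + 1)"
    and "residual (Suc m) \<mu> U (3 * a + 2) (3 * b) = csum U (3 * a + 2) (3 * b) - \<mu> * U (3 * a + 2) (3 * b)"
    and "residual (Suc m) \<mu> U (3 * a + 3) (3 * b + 1) = csum U (3 * a + 2) (3 * b) - \<mu> * U (3 * a + 3) (3 * b + 1)"
    and "residual (Suc m) \<mu> U (3 * a) (3 * b + 2) = csum U (3 * a) (3 * b + 2) - \<mu> * U (3 * a) (3 * b + 2)"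
    and "residual (Suc m) \<mu> U (3 * a + 1) (3 * b + 3) = csum U (3 * a) (3 * b + 2) - \<mu> * U (3 * a + 1) (3 * b + 3)"
    and "residual (Suc m) \<mu> U (3 * a + 3) (3 * b + 2) = csum U (3 * a + 2) (3 * b + 2) - \<mu> * U (3 * a + 3) (3 * b + 2)"
    and "residual (Suc m) \<mu> U (3 * a + 2) (3 * b + 3) = csum U (3 * a + 2) (3 * b + 2) - \<mu> * U (3 * a + 2) (3 * b + 3)"
  unfolding residual_def around_dead_end [OF assms] by (rule refl)+

lemma residual_junction:
  assumes "cell m a b"
  shows "residual (Suc m) \<mu> U (3 * a + 1) (3 * b + 1) =
      csum U (3 * a) (3 * b) + csum U (3 * a + 1) (3 * b + 1) - 2 * \<mu> * U (3 * a + 1) (3 * b + 1)"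
    and "residual (Suc m) \<mu> U (3 * a + 2) (3 * b + 1) =
      csum U (3 * a + 2) (3 * b) + csum U (3 * a + 1) (3 * b + 1) - 2 * \<mu> * U (3 * a + 2) (3 * b + 1)"
    and "residual (Suc m) \<mu> U (3 * a + 1) (3 * b + 2) =
      csum U (3 * a) (3 * b + 2) + csum U (3 * a + 1) (3 * b + 1) - 2 * \<mu> * U (3 * a + 1) (3 * b + 2)"
    and "residual (Suc m) \<mu> U (3 * a + 2) (3 * b + 2) =
      csum U (3 * a + 2) (3 * b + 2) + csum U (3 * a + 1) (3 * b + 1) - 2 * \<mu> * U (3 * a + 2) (3 * b + 2)"
  unfolding residual_def around_junction [OF assms] by simp_all

lemma csum_subcell:
  "csum U (3 * a) (3 * b) = U (3 * a) (3 * b) + (U (3 * a) (3 * b + 1) + U (3 * a + 1) (3 * b)) + U (3 * a + 1) (3 * b + 1)"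
  "csum U (3 * a + 2) (3 * b) = U (3 * a + 3) (3 * b) + (U (3 * a + 3) (3 * b + 1) + U (3 * a + 2) (3 * b)) + U (3 * a + 2) (3 * b + 1)"
  "csum U (3 * a) (3 * b + 2) = U (3 * a) (3 * b + 3) + (U (3 * a) (3 * b + 2) + U (3 * a + 1) (3 * b + 3)) + U (3 * a + 1) (3 * b + 2)"
  "csum U (3 * a + 2) (3 * b + 2) = U (3 * a + 3) (3 * b + 3) + (U (3 * a + 3) (3 * b + 2) + U (3 * a + 2) (3 * b + 3)) + U (3 * a + 2) (3 * b + 2)"
  "csum U (3 * a + 1) (3 * b + 1) = U (3 * a + 1) (3 * b + 1) + U (3 * a + 2) (3 * b + 1) + U (3 * a + 1) (3 * b + 2) + U (3 * a + 2) (3 * b + 2)"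
  by (simp_all add: csum_def add_ac)

text \<open>\<open>cell_elimination\<close> singles out its first corner, so it is instantiated once
  per corner with the roles permuted.\<close>

lemma residual_cell_Suc:
  assumes "cell m a b"
    and "i \<in> {0, 1}" "j \<in> {0, 1}"
  shows "\<mu> * (csum (\<lambda>x y. U (3 * x) (3 * y)) a b -
      residual_denom \<mu> * (2 * \<mu> - 7) * U (3 * (a + i)) (3 * (b + j))) =
    residual_denom \<mu> * (2 * \<mu> - 5) *
      (csum U (3 * a + 2 * i) (3 * b + 2 * j) - \<mu> * U (3 * (a + i)) (3 * (b + j))) +
    correction \<mu> (residual (Suc m) \<mu> U) a b i j"
proof -
  let ?r = "residual (Suc m) \<mu> U"
  have x: "csum (\<lambda>x y. U (3 * x) (3 * y)) a b =
      U (3 * a) (3 * b) + U (3 * a + 3) (3 * b) + U (3 * a) (3 * b + 3) + U (3 * a + 3) (3 * b + 3)"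
    by (simp add: csum_def)
  have e: "dead_ends ?r a b 0 0 = 2 * csum U (3 * a) (3 * b) - \<mu> * (U (3 * a) (3 * b + 1) + U (3 * a + 1) (3 * b))"
    "dead_ends ?r a b 1 0 = 2 * csum U (3 * a + 2) (3 * b) - \<mu> * (U (3 * a + 3) (3 * b + 1) + U (3 * a + 2) (3 * b))"
    "dead_ends ?r a b 0 1 = 2 * csum U (3 * a) (3 * b + 2) - \<mu> * (U (3 * a) (3 * b + 2) + U (3 * a + 1) (3 * b + 3))"
    "dead_ends ?r a b 1 1 = 2 * csum U (3 * a + 2) (3 * b + 2) - \<mu> * (U (3 * a + 3) (3 * b + 2) + U (3 * a + 2) (3 * b + 3))"
    using residual_dead_end [OF assms(1), of \<mu> U] by (simp_all add: dead_ends_def algebra_simps)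
  have r: "junction ?r a b 0 0 = csum U (3 * a) (3 * b) + csum U (3 * a + 1) (3 * b + 1) - 2 * \<mu> * U (3 * a + 1) (3 * b + 1)"
    "junction ?r a b 1 0 = csum U (3 * a + 2) (3 * b) + csum U (3 * a + 1) (3 * b + 1) - 2 * \<mu> * U (3 * a + 2) (3 * b + 1)"
    "junction ?r a b 0 1 = csum U (3 * a) (3 * b + 2) + csum U (3 * a + 1) (3 * b + 1) - 2 * \<mu> * U (3 * a + 1) (3 * b + 2)"
    "junction ?r a b 1 1 = csum U (3 * a + 2) (3 * b + 2) + csum U (3 * a + 1) (3 * b + 1) - 2 * \<mu> * U (3 * a + 2) (3 * b + 2)"
    using residual_junction [OF assms(1), of \<mu> U] by (simp_all add: junction_def add_ac)
  note S = csum_subcell [of U a b]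
  have S0: "csum U (3 * a + 1) (3 * b + 1) = U (3 * a + 2) (3 * b + 1) + U (3 * a + 1) (3 * b + 1) + U (3 * a + 1) (3 * b + 2) + U (3 * a + 2) (3 * b + 2)"
    "csum U (3 * a + 1) (3 * b + 1) = U (3 * a + 1) (3 * b + 2) + U (3 * a + 1) (3 * b + 1) + U (3 * a + 2) (3 * b + 1) + U (3 * a + 2) (3 * b + 2)"
    "csum U (3 * a + 1) (3 * b + 1) = U (3 * a + 2) (3 * b + 2) + U (3 * a + 1) (3 * b + 1) + U (3 * a + 2) (3 * b + 1) + U (3 * a + 1) (3 * b + 2)"
    using S(5) by simp_all
  note cell_elimination [OF S(1-5) e(1-4) r(1-4)]
    cell_elimination [OF S(2) S(1) S(3,4) S0(1) e(2) e(1) e(3,4) r(2) r(1) r(3,4)]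
    cell_elimination [OF S(3) S(1) S(2) S(4) S0(2) e(3) e(1) e(2) e(4) r(3) r(1) r(2) r(4)]
    cell_elimination [OF S(4) S(1) S(2) S(3) S0(3) e(4) e(1) e(2) e(3) r(4) r(1) r(2) r(3)]
  note elim = this
  consider "i = 0" "j = 0" | "i = 1" "j = 0" | "i = 0" "j = 1" | "i = 1" "j = 1"
    using assms(2,3) by blast
  thus ?thesis
  proof cases
    case 1
    thus ?thesis using elim(1) by (simp add: x correction_def add_ac)
  next
    case 2
    thus ?thesis using elim(2) by (simp add: x correction_def add_ac)
  next
    case 3
    thus ?thesis using elim(3) by (simp add: x correction_def add_ac)
  next
    case 4
    thus ?thesis using elim(4) by (simp add: x correction_def add_ac)
  qed
qed

lemma residual_Suc:
  "\<mu> * residual m (residual_denom \<mu> * (2 * \<mu> - 7)) (\<lambda>x y. U (3 * x) (3 * y)) x y =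
     residual_denom \<mu> * (2 * \<mu> - 5) * residual (Suc m) \<mu> U (3 * x) (3 * y) +
     around m (\<lambda>a b. correction \<mu> (residual (Suc m) \<mu> U) a b (x - a) (y - b)) x y"
proof -
  define q where "q = residual_denom \<mu>"
  define T where "T a b = csum (\<lambda>x y. U (3 * x) (3 * y)) a b - q * (2 * \<mu> - 7) * U (3 * x) (3 * y)" for a b
  \<comment> \<open>The subcell of \<open>(a, b)\<close> at the corner \<open>(x, y)\<close> starts
    at \<open>3 * a + 2 * (x - a) = 2 * x + a\<close>, and likewise for \<open>y\<close>.\<close>
  define h where "h a b = csum U (2 * x + a) (2 * y + b) - \<mu> * U (3 * x) (3 * y)" for a b
  define K where "K a b = correction \<mu> (residual (Suc m) \<mu> U) a b (x - a) (y - b)" for a b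
  have step: "\<mu> * T a b = q * (2 * \<mu> - 5) * h a b + K a b"
    if "cell m a b" "(a, b) \<in> {(x, y), (x - 1, y), (x, y - 1), (x - 1, y - 1)}" for a b
  proof -
    have "x - a \<in> {0, 1}" "y - b \<in> {0, 1}" using that(2) by auto
    from residual_cell_Suc [OF that(1) this, of \<mu> U] show ?thesis
      by (simp add: T_def h_def K_def q_def algebra_simps)
  qed
  have R: "residual m (q * (2 * \<mu> - 7)) (\<lambda>x y. U (3 * x) (3 * y)) x y = around m T x y"
    unfolding residual_def T_def ..
  have "residual (Suc m) \<mu> U (3 * x) (3 * y) = around m h x y"
    unfolding residual_def around_Suc_vertex
    by (simp add: around_def h_def algebra_simps)
  moreover have "\<mu> * around m T x y = q * (2 * \<mu> - 5) * around m h x y + around m K x y"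
    using step by (simp add: around_def of_bool_def distrib_left add_ac)
  ultimately show ?thesis unfolding R q_def [symmetric] K_def by simp
qed

lemma residual_bound_Suc:
  assumes bound: "\<And>x y. \<bar>residual (Suc m) \<mu> U x y\<bar> \<le> 3 * ncells (Suc m) x y * \<epsilon>"
    and \<mu>: "7 / 2 \<le> \<mu>" "\<mu> \<le> 4"
  shows "\<bar>residual m (residual_denom \<mu> * (2 * \<mu> - 7)) (\<lambda>x y. U (3 * x) (3 * y)) x y\<bar> \<le>
    3 * ncells m x y * (15 * \<epsilon>)"
proof -
  define q where "q = residual_denom \<mu>"
  let ?r = "residual (Suc m) \<mu> U"
  let ?K = "\<lambda>a b. correction \<mu> ?r a b (x - a) (y - b)"
  \<comment> \<open>A dead end lies in one cell and a junction in two, so each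
    \<open>dead_ends\<close> and each \<open>junction\<close> is at most
    \<open>6 * \<epsilon>\<close>. Hence 18 = 2 * 6 + 6 and 24 = 4 * 6.\<close>
  let ?k = "q * (18 * \<epsilon>) + 24 * \<epsilon> + (\<mu> - 2) * (24 * \<epsilon>)"
  have "q = 1 + (\<mu> - 7 / 2) * (2 * \<mu> - 2)"
    by (simp add: q_def power2_eq_square algebra_simps)
  moreover have "0 \<le> (\<mu> - 7 / 2) * (2 * \<mu> - 2)"
    using \<mu> by (intro mult_nonneg_nonneg) auto
  ultimately have q: "0 \<le> q" by linarith
  have ab: "\<bar>?K a b\<bar> \<le> ?k"
    if "cell m a b" "(a, b) \<in> {(x, y), (x - 1, y), (x, y - 1), (x - 1, y - 1)}" for a b
  proof -
    have dead: "\<bar>dead_ends ?r a b i j\<bar> \<le> 6 * \<epsilon>" and junc: "\<bar>junction ?r a b i j\<bar> \<le> 6 * \<epsilon>"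
      if ij: "i \<in> {0, 1}" "j \<in> {0, 1}" for i j
    proof -
      have n: "ncells (Suc m) (3 * a + 3 * i) (3 * b + 1 + j) = 1"
        "ncells (Suc m) (3 * a + 1 + i) (3 * b + 3 * j) = 1"
        "ncells (Suc m) (3 * a + 1 + i) (3 * b + 1 + j) = 2"
        using ij around_dead_end [OF \<open>cell m a b\<close>, of "\<lambda>_ _. 1"]
          around_junction [OF \<open>cell m a b\<close>, of "\<lambda>_ _. 1"]
        by (auto simp: add_ac simp del: cell.simps)
      show "\<bar>dead_ends ?r a b i j\<bar> \<le> 6 * \<epsilon>"
        unfolding dead_ends_def
        using bound [of "3 * a + 3 * i" "3 * b + 1 + j"] bound [of "3 * a + 1 + i" "3 * b + 3 * j"]
        unfolding n by linarith
      show "\<bar>junction ?r a b i j\<bar> \<le> 6 * \<epsilon>"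
        unfolding junction_def using bound [of "3 * a + 1 + i" "3 * b + 1 + j"] unfolding n by linarith
    qed
    have ij: "x - a \<in> {0, 1}" "y - b \<in> {0, 1}" using that(2) by auto
    have "\<bar>q * (2 * dead_ends ?r a b (x - a) (y - b) + junction ?r a b (x - a) (y - b))\<bar> \<le> q * (18 * \<epsilon>)"
      unfolding abs_mult using q dead [OF ij] junc [OF ij] by (intro mult_mono) auto
    moreover have "\<bar>dead_ends ?r a b 0 0 + dead_ends ?r a b 1 0 + dead_ends ?r a b 0 1 + dead_ends ?r a b 1 1\<bar> \<le> 24 * \<epsilon>"
      using dead [of 0 0] dead [of 1 0] dead [of 0 1] dead [of 1 1] by simp
    moreover have "\<bar>(\<mu> - 2) * (junction ?r a b 0 0 + junction ?r a b 1 0 + junction ?r a b 0 1 + junction ?r a b 1 1)\<bar> \<le> (\<mu> - 2) * (24 * \<epsilon>)"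
      unfolding abs_mult using \<mu> junc [of 0 0] junc [of 1 0] junc [of 0 1] junc [of 1 1]
      by (intro mult_mono) auto
    ultimately show ?thesis
      unfolding correction_def q_def [symmetric] by linarith
  qed
  have summand: "\<bar>of_bool (cell m a b) * ?K a b\<bar> \<le> of_bool (cell m a b) * ?k"
    if "(a, b) \<in> {(x, y), (x - 1, y), (x, y - 1), (x - 1, y - 1)}" for a b
    using ab [OF _ that] by (cases "cell m a b") auto
  have "\<bar>around m ?K x y\<bar> \<le> of_bool (cell m x y) * ?k + of_bool (cell m (x - 1) y) * ?k +
      of_bool (cell m x (y - 1)) * ?k + of_bool (cell m (x - 1) (y - 1)) * ?k"
    unfolding around_def
    using summand [OF insertI1] summand [OF insertI2, OF insertI1]
      summand [OF insertI2, OF insertI2, OF insertI1]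
      summand [OF insertI2, OF insertI2, OF insertI2, OF insertI1]
    by linarith
  also have "\<dots> = ncells m x y * ?k"
    by (simp add: around_def distrib_right)
  finally have K: "\<bar>around m ?K x y\<bar> \<le> ncells m x y * ?k" .
  have "ncells (Suc m) (3 * x) (3 * y) = ncells m x y"
    unfolding around_Suc_vertex by (simp add: around_def)
  hence vertex: "\<bar>?r (3 * x) (3 * y)\<bar> \<le> 3 * ncells m x y * \<epsilon>"
    using bound [of "3 * x" "3 * y"] by simp
  have V: "\<bar>q * (2 * \<mu> - 5) * ?r (3 * x) (3 * y)\<bar> \<le> q * (2 * \<mu> - 5) * (3 * ncells m x y * \<epsilon>)"
    unfolding abs_mult [of "q * (2 * \<mu> - 5)"] using q \<mu> vertex by (intro mult_mono) auto
  \<comment> \<open>The sign of \<open>\<epsilon>\<close> is forced by the bound itself wherever a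
    cell is present.\<close>
  have \<epsilon>: "0 \<le> ncells m x y * \<epsilon>"
    using order_trans [OF abs_ge_zero vertex] by (simp add: mult.commute)
  have "\<mu> * \<bar>residual m (q * (2 * \<mu> - 7)) (\<lambda>x y. U (3 * x) (3 * y)) x y\<bar> =
      \<bar>\<mu> * residual m (q * (2 * \<mu> - 7)) (\<lambda>x y. U (3 * x) (3 * y)) x y\<bar>"
    using \<mu> by (simp add: abs_mult)
  also have "\<dots> \<le> q * (2 * \<mu> - 5) * (3 * ncells m x y * \<epsilon>) + ncells m x y * ?k"
    unfolding q_def residual_Suc unfolding q_def [symmetric] using V K by linarith
  \<comment> \<open>The total of all coefficients is divisible by \<open>\<mu>\<close>; the quotient
    reaches 15 exactly at \<open>\<mu> = 4\<close>, that is, at eigenvalue 0.\<close>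
  also have "\<dots> = \<mu> * (3 * (ncells m x y * \<epsilon>) * (4 * \<mu>\<^sup>2 - 16 * \<mu> + 15))"
    by (simp add: q_def power2_eq_square algebra_simps)
  also have "\<dots> \<le> \<mu> * (3 * (ncells m x y * \<epsilon>) * 15)"
  proof (intro mult_left_mono)
    have "0 \<le> \<mu> * (4 - \<mu>)" using \<mu> by simp
    thus "4 * \<mu>\<^sup>2 - 16 * \<mu> + 15 \<le> 15" by (simp add: power2_eq_square algebra_simps)
  qed (use \<epsilon> \<mu> in auto)
  finally show ?thesis using \<mu> unfolding q_def by simp
qed

lemma residual_zero_Suc:
  assumes "\<And>x y. residual (Suc m) \<mu> U x y = 0" and "\<mu> \<noteq> 0"
  shows "residual m (residual_denom \<mu> * (2 * \<mu> - 7)) (\<lambda>x y. U (3 * x) (3 * y)) x y = 0"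
  using residual_Suc [of \<mu> m U x y] assms
  by (simp add: around_def correction_def dead_ends_def junction_def)

text \<open>The subcells of a parent cell have as vertices its four corners and, for each corner,
  two dead ends and a junction. One use of \<open>cell_extension_zero\<close> per corner covers all
  new vertices.\<close>

lemma extension_zero:
  assumes r: "\<And>x y. residual (Suc m) \<mu> U x y = 0"
    and \<mu>: "\<mu> \<noteq> 0" "residual_denom \<mu> \<noteq> 0" "2 * \<mu> - 5 \<noteq> 0"
    and U: "\<And>a b x y. cell m a b \<Longrightarrow> corner a b x y \<Longrightarrow> U (3 * x) (3 * y) = 0"
    and "cell (Suc m) a b" "corner a b x y"
  shows "U x y = 0"
proof -
  obtain c d where cd: "cell m c d"
    "(a, b) \<in> {(3 * c + 1, 3 * d + 1), (3 * c, 3 * d), (3 * c + 2, 3 * d),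
       (3 * c, 3 * d + 2), (3 * c + 2, 3 * d + 2)}"
    using cell_SucE [OF assms(6)] .
  have "U (3 * c) (3 * d) = 0" "U (3 * (c + 1)) (3 * d) = 0" "U (3 * c) (3 * (d + 1)) = 0"
    "U (3 * (c + 1)) (3 * (d + 1)) = 0"
    by (rule U [OF cd(1)]; simp add: corner_def)+
  hence x: "U (3 * c) (3 * d) = 0" "U (3 * c + 3) (3 * d) = 0" "U (3 * c) (3 * d + 3) = 0"
    "U (3 * c + 3) (3 * d + 3) = 0" by (simp_all add: distrib_left)
  note S = csum_subcell [of U c d, unfolded x add_0]
  have S0: "csum U (3 * c + 1) (3 * d + 1) = U (3 * c + 2) (3 * d + 1) + U (3 * c + 1) (3 * d + 1) + U (3 * c + 1) (3 * d + 2) + U (3 * c + 2) (3 * d + 2)"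
    "csum U (3 * c + 1) (3 * d + 1) = U (3 * c + 1) (3 * d + 2) + U (3 * c + 1) (3 * d + 1) + U (3 * c + 2) (3 * d + 1) + U (3 * c + 2) (3 * d + 2)"
    "csum U (3 * c + 1) (3 * d + 1) = U (3 * c + 2) (3 * d + 2) + U (3 * c + 1) (3 * d + 1) + U (3 * c + 2) (3 * d + 1) + U (3 * c + 1) (3 * d + 2)"
    using S(5) by simp_all
  note e = residual_dead_end [OF cd(1), of \<mu> U, unfolded r, symmetric]
  note j = residual_junction [OF cd(1), of \<mu> U, unfolded r, symmetric]
  have "U (3 * c) (3 * d + 1) = 0 \<and> U (3 * c + 1) (3 * d) = 0 \<and> U (3 * c + 1) (3 * d + 1) = 0"
    by (rule cell_extension_zero [OF S(1-5) e(2) e(1) e(4) e(3) e(5,6) e(7,8) j(1-4) \<mu>])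
  moreover have "U (3 * c + 3) (3 * d + 1) = 0 \<and> U (3 * c + 2) (3 * d) = 0 \<and> U (3 * c + 2) (3 * d + 1) = 0"
    by (rule cell_extension_zero [OF S(2) S(1) S(3,4) S0(1) e(4) e(3) e(2) e(1) e(5,6) e(7,8) j(2) j(1) j(3,4) \<mu>])
  moreover have "U (3 * c) (3 * d + 2) = 0 \<and> U (3 * c + 1) (3 * d + 3) = 0 \<and> U (3 * c + 1) (3 * d + 2) = 0"
    by (rule cell_extension_zero [OF S(3) S(1,2) S(4) S0(2) e(5,6) e(2) e(1) e(4) e(3) e(7,8) j(3) j(1,2) j(4) \<mu>])
  moreover have "U (3 * c + 3) (3 * d + 2) = 0 \<and> U (3 * c + 2) (3 * d + 3) = 0 \<and> U (3 * c + 2) (3 * d + 2) = 0"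
    by (rule cell_extension_zero [OF S(4) S(1-3) S0(3) e(7,8) e(2) e(1) e(4) e(3) e(5,6) j(4) j(1-3) \<mu>])
  ultimately show ?thesis
    using cd(2) assms(7) x by (auto simp: corner_def add_ac)
qed

section \<open>The eigenvalue sequences of the 0-series\<close>

lemma decimation_R_IVT:
  assumes "a \<le> b" "(decimation_R a \<le> t \<and> t \<le> decimation_R b) \<or> (decimation_R b \<le> t \<and> t \<le> decimation_R a)"
  obtains x where "a \<le> x" "x \<le> b" "decimation_R x = t"
proof -
  have "isCont decimation_R x" for x
    unfolding decimation_R_def by (intro continuous_intros)
  thus ?thesis
    using IVT [of decimation_R a t b] IVT2 [of decimation_R b t a] assms that by blast
qed

text \<open>Vieta's formula, from difference quotients. In \<open>phi_roots\<close> it rules out a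
  fourth root, since two roots determine the third.\<close>

lemma decimation_R_roots_sum:
  assumes "decimation_R a = t" "decimation_R b = t" "decimation_R c = t" "a \<noteq> b" "a \<noteq> c" "b \<noteq> c"
  shows "a + b + c = 4 / 3"
proof -
  have quot: "36 * (a\<^sup>2 + a * y + y\<^sup>2) - 48 * (a + y) + 15 = 0" if "decimation_R y = t" "a \<noteq> y" for y
  proof -
    have "(a - y) * (36 * (a\<^sup>2 + a * y + y\<^sup>2) - 48 * (a + y) + 15) = decimation_R a - decimation_R y"
      by (simp add: decimation_R_def power2_eq_square power3_eq_cube algebra_simps)
    thus ?thesis using that assms(1) by simp
  qed
  have "(b - c) * (36 * (a + b + c) - 48) = 0"
    using quot [OF assms(2,4)] quot [OF assms(3,5)] by (simp add: power2_eq_square algebra_simps)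
  thus ?thesis using assms(6) by simp
qed

lemma phi_roots:
  assumes "decimation_R a = t" "decimation_R b = t" "decimation_R c = t" "a < b" "b < c"
  shows "phi 1 t = a" "phi 2 t = b" "phi 3 t = c"
proof -
  have "{x. decimation_R x = t} = set [a, b, c]"
  proof -
    have "x \<in> {a, b, c}" if "decimation_R x = t" for x
      using decimation_R_roots_sum [of a t b c] decimation_R_roots_sum [of a t b x] assms that
      by (cases "x = a"; cases "x = b") auto
    moreover have "decimation_R x = t" if "x \<in> {a, b, c}" for x
      using that assms(1-3) by blast
    ultimately show ?thesis by (simp add: set_eq_iff) blast
  qed
  hence "sorted_list_of_set {x. decimation_R x = t} = sort (remdups [a, b, c])"
    by (simp only: sorted_list_of_set_sort_remdups)
  also have "\<dots> = [a, b, c]" using assms by auto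
  finally have "sorted_list_of_set {x. decimation_R x = t} = [a, b, c]" .
  thus "phi 1 t = a" "phi 2 t = b" "phi 3 t = c"
    by (simp_all add: phi_def)
qed

lemma phi_properties:
  assumes "0 \<le> t" "t \<le> 1"
  shows "phi 1 t \<le> 1 / 6"
    and "j \<in> {1, 2, 3} \<Longrightarrow> decimation_R (phi j t) = t \<and> 0 \<le> phi j t \<and> phi j t \<le> 1"
proof -
  \<comment> \<open>The points 1/6 and 1/4 lie on either side of the local maximum and their values
    exceed 1. This yields three disjoint brackets, each with a root for every \<open>t\<close> in
    [0, 1].\<close>
  have R: "decimation_R 0 = 0" "decimation_R (1/6) = 4 / 3" "decimation_R (1/4) = 21 / 16"
    "decimation_R (1/2) = 0" "decimation_R (5/6) = 0" "decimation_R 1 = 3"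
    by (simp_all add: decimation_R_def power2_eq_square power3_eq_cube)
  obtain a where a: "0 \<le> a" "a \<le> 1/6" "decimation_R a = t"
    using decimation_R_IVT [of 0 "1/6" t] R assms by auto
  obtain b where b: "1/4 \<le> b" "b \<le> 1/2" "decimation_R b = t"
    using decimation_R_IVT [of "1/4" "1/2" t] R assms by auto
  obtain c where c: "5/6 \<le> c" "c \<le> 1" "decimation_R c = t"
    using decimation_R_IVT [of "5/6" 1 t] R assms by auto
  note phi = phi_roots [OF a(3) b(3) c(3)]
  show "phi 1 t \<le> 1 / 6" using phi(1) a b c by auto
  show "decimation_R (phi j t) = t \<and> 0 \<le> phi j t \<and> phi j t \<le> 1" if "j \<in> {1, 2, 3}"
    using that phi a b c by auto
qed

lemma phi_zero: "phi 1 0 = 0" "phi 2 0 = 1 / 2" "phi 3 0 = 5 / 6"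
  using phi_roots [of 0 0 "1/2" "5/6"]
  by (simp_all add: decimation_R_def power2_eq_square power3_eq_cube)

lemma grid_Suc_fun: "(\<lambda>x y. grid u (Suc m) (3 * x) (3 * y)) = grid u m"
  by (intro ext grid_Suc)

lemma vicsek_eq_closure: "vicsek = closure (\<Union>m. V m)"
  by (rule self_similar_set_unique [OF self_similar_set_vicsek self_similar_set_closure])

lemma V_subset_vicsek: "V m \<subseteq> vicsek"
  unfolding vicsek_eq_closure using closure_subset [of "\<Union>m. V m"] by (auto simp del: V.simps)

locale zero_series =
  fixes w :: "nat \<Rightarrow> nat"
  assumes range_w: "\<And>j. j \<ge> 1 \<Longrightarrow> w j \<in> {1, 2, 3}"
    and finite_w: "finite {j. j \<ge> 1 \<and> w j \<noteq> 1}"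
    and first_w: "\<And>j. j \<ge> 1 \<Longrightarrow> w j \<noteq> 1 \<Longrightarrow> \<forall>i\<in>{1..<j}. w i = 1 \<Longrightarrow> w j = 3"
begin

definition ev :: "nat \<Rightarrow> real" where
  "ev m = phi_comp w m 0"

definition mu :: "nat \<Rightarrow> real" where
  "mu m = 4 - 3 * ev m"

lemma ev_bounds: "0 \<le> ev m \<and> ev m \<le> 1"
proof (induction m)
  case (Suc m)
  thus ?case using phi_properties(2) [of "ev m" "w (Suc m)"] range_w [of "Suc m"]
    by (simp add: ev_def)
qed (simp add: ev_def)

lemma decimation_R_ev: "decimation_R (ev (Suc m)) = ev m"
  using phi_properties(2) [of "ev m" "w (Suc m)"] range_w [of "Suc m"] ev_bounds [of m]
  by (simp add: ev_def)

lemma mu_0 [simp]: "mu 0 = 4"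
  by (simp add: mu_def ev_def)

lemma mu_decimation: "mu m = residual_denom (mu (Suc m)) * (2 * mu (Suc m) - 7)"
  unfolding mu_def decimation_R_denom [symmetric] decimation_R_ev ..

lemma mu_pos: "0 < mu m" "mu m \<le> 4"
  using ev_bounds [of m] by (auto simp: mu_def)

text \<open>By \<open>mu_decimation\<close> this is a factor of the positive number
  \<open>mu m\<close>.\<close>

lemma residual_denom_mu: "residual_denom (mu (Suc m)) \<noteq> 0"
  using mu_decimation [of m] mu_pos(1) [of m] by auto

lemma ev_eq_zero_iff: "ev m = 0 \<longleftrightarrow> (\<forall>i\<in>{1..m}. w i = 1)"
proof (induction m)
  case (Suc m)
  have "ev (Suc m) = 0 \<longleftrightarrow> ev m = 0 \<and> w (Suc m) = 1"
  proof
    assume "ev (Suc m) = 0"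
    moreover from this have "ev m = 0"
      using decimation_R_ev [of m] by (simp add: decimation_R_def)
    ultimately show "ev m = 0 \<and> w (Suc m) = 1"
      using range_w [of "Suc m"] phi_zero by (auto simp: ev_def)
  next
    assume "ev m = 0 \<and> w (Suc m) = 1"
    thus "ev (Suc m) = 0" using phi_zero by (simp add: ev_def)
  qed
  thus ?case using Suc.IH by (auto simp: atLeastAtMostSuc_conv)
qed (simp add: ev_def)

text \<open>The value 1/2 can only be reached from 0, when all earlier letters are 1. By
  \<open>first_w\<close> the next letter is then 1 or 3, and these branches lead to 0 and
  5/6.\<close>

lemma ev_neq_half: "ev (Suc m) \<noteq> 1 / 2"
proof
  assume half: "ev (Suc m) = 1 / 2"
  hence "ev m = 0"
    using decimation_R_ev [of m] unfolding half
    by (simp add: decimation_R_def power2_eq_square power3_eq_cube)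
  moreover from this have "w (Suc m) \<noteq> 1 \<Longrightarrow> w (Suc m) = 3"
    using first_w [of "Suc m"] ev_eq_zero_iff [of m] by (auto simp: atLeastLessThanSuc_atLeastAtMost)
  ultimately show False
    using half phi_zero by (cases "w (Suc m) = 1") (auto simp: ev_def)
qed

lemma mu_neq: "2 * mu (Suc m) - 5 \<noteq> 0"
  using ev_neq_half [of m] by (simp add: mu_def)

lemma eventually_mu: "\<exists>M. \<forall>m\<ge>M. 7 / 2 \<le> mu (Suc m)"
proof -
  obtain M where M: "\<And>j. j \<ge> 1 \<and> w j \<noteq> 1 \<Longrightarrow> j < M"
    using finite_w by (auto simp: finite_nat_set_iff_bounded)
  have "7 / 2 \<le> mu (Suc m)" if "m \<ge> M" for m
  proof -
    have "w (Suc m) = 1" using M [of "Suc m"] that by auto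
    thus ?thesis using phi_properties(1) [of "ev m"] ev_bounds [of m] by (simp add: mu_def ev_def)
  qed
  thus ?thesis by blast
qed

section \<open>Eigenfunctions of the 0-series\<close>

lemma residual_bound_descend:
  assumes "\<And>x y. \<bar>residual (m + k) (mu (m + k)) (grid u (m + k)) x y\<bar> \<le> 3 * ncells (m + k) x y * \<epsilon>"
    and "\<And>i. i \<ge> m \<Longrightarrow> 7 / 2 \<le> mu (Suc i)"
  shows "\<bar>residual m (mu m) (grid u m) x y\<bar> \<le> 3 * ncells m x y * (15 ^ k * \<epsilon>)"
  using assms(1)
proof (induction k arbitrary: x y \<epsilon>)
  case (Suc k)
  have "\<bar>residual (m + k) (mu (m + k)) (grid u (m + k)) x y\<bar> \<le> 3 * ncells (m + k) x y * (15 * \<epsilon>)" for x y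
    using residual_bound_Suc [of "m + k" "mu (Suc (m + k))" "grid u (Suc (m + k))" \<epsilon> x y]
      Suc.prems assms(2) [of "m + k"] mu_pos(2)
    unfolding mu_decimation [symmetric] grid_Suc_fun by simp
  from Suc.IH [OF this] show ?case by (simp add: mult_ac)
qed simp

lemma residual_eq_zero:
  assumes "neumann_eigenfunction l u" and lim: "(\<lambda>m. 15 ^ m * ev m) \<longlonglongrightarrow> l"
  shows "residual m (mu m) (grid u m) x y = 0"
proof -
  have cont: "continuous_on vicsek u"
    and lap: "\<And>e. e > 0 \<Longrightarrow> \<forall>\<^sub>F m in sequentially. \<forall>x\<in>V m.
      dist (15 ^ m * graph_laplacian m u x) (- (l * u x)) < e"
    using assms(1) unfolding neumann_eigenfunction_def has_neumann_laplacian_def by auto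
  have "compact vicsek" using self_similar_set_vicsek by (simp add: self_similar_set_def)
  from compact_imp_bounded [OF compact_continuous_image [OF cont this]]
  obtain B where B: "B > 0" "\<And>p. p \<in> vicsek \<Longrightarrow> \<bar>u p\<bar> \<le> B"
    by (auto simp: bounded_pos)
  have small: "\<forall>\<^sub>F m in sequentially. \<forall>x y.
      \<bar>residual m (mu m) (grid u m) x y\<bar> \<le> 3 * ncells m x y * (e / 15 ^ m)" if "e > 0" for e
  proof -
    \<comment> \<open>Two errors of size \<open>e / 2\<close>: that of the scaled eigenvalue,
      multiplied by the bound \<open>B\<close> on \<open>u\<close>, and that of the scaled
      Laplacian.\<close>
    have "\<forall>\<^sub>F m in sequentially. dist (15 ^ m * ev m) l < e / (2 * B)"
      using lim that B(1) by (intro tendstoD) auto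
    moreover have "\<forall>\<^sub>F m in sequentially. \<forall>x\<in>V m. dist (15 ^ m * graph_laplacian m u x) (- (l * u x)) < e / 2"
      using that by (intro lap) simp
    ultimately show ?thesis
    proof eventually_elim
      case (elim m)
      show ?case
      proof (intro allI)
        fix x y
        let ?p = "scaled m x y"
        show "\<bar>residual m (mu m) (grid u m) x y\<bar> \<le> 3 * ncells m x y * (e / 15 ^ m)"
        proof (cases "ncells m x y = 0")
          case True
          thus ?thesis unfolding mu_def residual_eq_laplacian by simp
        next
          case False
          hence "\<exists>a b. cell m a b \<and> corner a b x y \<and> True"
            unfolding cell_corner_ex by (auto simp: around_def)
          hence V: "?p \<in> V m" unfolding V_iff_corner by blast
          have "\<bar>u ?p\<bar> \<le> B"
            using B(2) V V_subset_vicsek by blast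
          hence ev: "\<bar>(15 ^ m * ev m - l) * u ?p\<bar> \<le> e / (2 * B) * B"
            unfolding abs_mult using elim(1) B(1) that
            by (intro mult_mono) (auto simp: dist_real_def)
          have lap: "\<bar>15 ^ m * graph_laplacian m u ?p + l * u ?p\<bar> < e / 2"
            using elim(2) V by (auto simp: dist_real_def)
          have "e / (2 * B) * B = e / 2" using B(1) by simp
          moreover have "15 ^ m * (graph_laplacian m u ?p + ev m * u ?p) =
              (15 ^ m * ev m - l) * u ?p + (15 ^ m * graph_laplacian m u ?p + l * u ?p)"
            by (simp add: algebra_simps)
          ultimately have "\<bar>15 ^ m * (graph_laplacian m u ?p + ev m * u ?p)\<bar> \<le> e"
            using ev lap by linarith
          hence "\<bar>graph_laplacian m u ?p + ev m * u ?p\<bar> \<le> e / 15 ^ m"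
            unfolding abs_mult by (simp add: field_simps)
          thus ?thesis
            unfolding mu_def residual_eq_laplacian abs_mult
            by (intro mult_mono) (auto simp: around_def)
        qed
      qed
    qed
  qed
  obtain M where M: "\<And>m. m \<ge> M \<Longrightarrow> 7 / 2 \<le> mu (Suc m)"
    using eventually_mu by blast
  have large: "residual m (mu m) (grid u m) x y = 0" if m: "m \<ge> M" for m x y
  proof -
    let ?C = "3 * ncells m x y / 15 ^ m"
    \<comment> \<open>Descending from level \<open>n\<close> costs \<open>15 ^ (n - m)\<close>
      against the available \<open>e / 15 ^ n\<close>, so the result does not depend on
      \<open>n\<close>.\<close>
    have bound: "\<bar>residual m (mu m) (grid u m) x y\<bar> \<le> ?C * e" if e: "e > 0" for e
    proof -
      obtain n where n: "n \<ge> m" "\<And>x y.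
          \<bar>residual n (mu n) (grid u n) x y\<bar> \<le> 3 * ncells n x y * (e / 15 ^ n)"
        using small [OF e] unfolding eventually_sequentially by (meson nle_le)
      have "\<bar>residual (m + (n - m)) (mu (m + (n - m))) (grid u (m + (n - m))) x y\<bar>
          \<le> 3 * ncells (m + (n - m)) x y * (e / 15 ^ n)" for x y
        using n by simp
      from residual_bound_descend [OF this M]
      have "\<bar>residual m (mu m) (grid u m) x y\<bar> \<le> 3 * ncells m x y * (15 ^ (n - m) * (e / 15 ^ n))"
        using m by simp
      also have "\<dots> = ?C * e"
        using n(1) by (simp add: power_diff field_simps)
      finally show ?thesis .
    qed
    have C: "0 \<le> ?C" by (simp add: around_def)
    have "\<bar>residual m (mu m) (grid u m) x y\<bar> \<le> 0 + d" if d: "d > 0" for d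
    proof -
      have "\<bar>residual m (mu m) (grid u m) x y\<bar> \<le> ?C * (d / (?C + 1))"
        using C d by (intro bound divide_pos_pos add_nonneg_pos) auto
      also have "\<dots> \<le> (?C + 1) * (d / (?C + 1))"
        using C d by (intro mult_right_mono divide_nonneg_pos) auto
      also have "\<dots> = d" using C by simp
      finally show ?thesis by simp
    qed
    hence "\<bar>residual m (mu m) (grid u m) x y\<bar> \<le> 0"
      by (rule field_le_epsilon)
    thus ?thesis by simp
  qed
  \<comment> \<open>Below \<open>M\<close> exact vanishing is passed down one level at a time, where
    \<open>mu\<close> being nonzero suffices.\<close>
  have "m \<le> max m M" by simp
  thus ?thesis
  proof (induction arbitrary: x y rule: inc_induct)
    case base
    show ?case by (simp add: large)
  next
    case (step n)
    from residual_zero_Suc [OF step.IH less_imp_neq [OF mu_pos(1), symmetric], of x y]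
    show ?case unfolding mu_decimation [symmetric] grid_Suc_fun .
  qed
qed

text \<open>The vertices \<open>(0, 0)\<close>, \<open>(1, 0)\<close> and \<open>(0, 1)\<close> lie
  in no cell but the one at the origin. Their equations equate \<open>mu m\<close> times each value
  with the same cell sum, so the three values agree and the sum yields the fourth.\<close>

lemma grid_corner:
  assumes "\<And>x y. residual m (mu m) (grid u m) x y = 0"
  shows "grid u m 1 0 = u (0, 0)" "grid u m 0 1 = u (0, 0)" "grid u m 1 1 = (mu m - 3) * u (0, 0)"
proof -
  have "\<not> cell m a b" if "a < 0 \<or> b < 0 \<or> odd (a + b)" for a b
    using that cell_nonneg [of m a b] cell_even [of m a b] by auto
  hence "csum (grid u m) 0 0 = mu m * grid u m x y" if "(x, y) \<in> {(0, 0), (1, 0), (0, 1)}" for x y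
    using assms [of x y] that cell_origin [of m] by (auto simp: residual_def around_def)
  from this [of 0 0] this [of 1 0] this [of 0 1] show "grid u m 1 0 = u (0, 0)" "grid u m 0 1 = u (0, 0)"
    "grid u m 1 1 = (mu m - 3) * u (0, 0)"
    using mu_pos(1) [of m] by (auto simp: csum_def grid_def algebra_simps)
qed

lemma zero_on_vicsek:
  assumes res: "\<And>m x y. residual m (mu m) (grid u m) x y = 0"
    and cont: "continuous_on vicsek u" and "u (0, 0) = 0"
    and "p \<in> vicsek"
  shows "u p = 0"
proof -
  have "grid u m x y = 0" if "cell m a b" "corner a b x y" for m a b x y
    using that
  proof (induction m arbitrary: a b x y)
    case 0
    have "grid u 0 0 0 = 0" using assms(3) by (simp add: grid_def)
    \<comment> \<open>On level 0 the cell at the origin is the whole graph, so all values are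
      multiples of \<open>u (0, 0)\<close>.\<close>
    thus ?case using 0 grid_corner [OF res, of 0] assms(3) by (auto simp: corner_def)
  next
    case (Suc m)
    show ?case
    proof (rule extension_zero [OF res _ residual_denom_mu mu_neq _ Suc.prems])
      show "mu (Suc m) \<noteq> 0" using mu_pos(1) [of "Suc m"] by simp
      show "grid u (Suc m) (3 * x) (3 * y) = 0" if "cell m a b" "corner a b x y" for a b x y
        unfolding grid_Suc using Suc.IH [OF that] .
    qed
  qed
  hence "u p = 0" if "p \<in> V m" for p m
    using that unfolding V_iff_corner by (auto simp: grid_def scaled_def)
  moreover have "continuous_on (closure (\<Union>m. V m)) u" "p \<in> closure (\<Union>m. V m)"
    using cont assms(4) unfolding vicsek_eq_closure by simp_all
  ultimately show ?thesis
    using continuous_constant_on_closure [of "\<Union>m. V m" u 0 p] by blast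
qed

end

section \<open>Recovering an eigenfunction from the diagonal\<close>

lemma zero_series_eigenfunction_decimation:
  assumes "zero_series_eigenfunction u"
  shows "\<exists>w. zero_series w \<and> (\<forall>m x y. residual m (zero_series.mu w m) (grid u m) x y = 0) \<and>
    continuous_on vicsek u \<and> u (0, 0) \<noteq> 0"
proof -
  obtain l w where w: "zero_series w" and lim: "(\<lambda>m. 15 ^ m * phi_comp w m 0) \<longlonglongrightarrow> l"
    and u: "neumann_eigenfunction l u"
    using assms unfolding zero_series_eigenfunction_def zero_series_eigenvalue_def zero_series_def
    by blast
  interpret zero_series w by (rule w)
  have res: "residual m (mu m) (grid u m) x y = 0" for m x y
    using residual_eq_zero [OF u] lim by (simp add: ev_def)
  have cont: "continuous_on vicsek u" and nz: "\<exists>x\<in>vicsek. u x \<noteq> 0"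
    using u unfolding neumann_eigenfunction_def has_neumann_laplacian_def by auto
  have "u (0, 0) \<noteq> 0"
    using zero_on_vicsek [OF res cont] nz by blast
  thus ?thesis using w res cont by blast
qed

lemma residual_diff:
  "residual m \<mu> (grid (\<lambda>x. u x - v x) m) x y = residual m \<mu> (grid u m) x y - residual m \<mu> (grid v m) x y"
  by (simp add: residual_def around_def csum_def grid_def algebra_simps)

theorem theorem6p1:
  fixes u\<^sub>1 u\<^sub>2 :: "real \<times> real \<Rightarrow> real"
  assumes "zero_series_eigenfunction u\<^sub>1"
    and "zero_series_eigenfunction u\<^sub>2"
    and "\<forall>x\<in>diagonal. u\<^sub>1 x = u\<^sub>2 x"
  shows "\<forall>x\<in>vicsek. u\<^sub>1 x = u\<^sub>2 x"
proof
  fix p assume p: "p \<in> vicsek"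
  obtain w1 where w1: "zero_series w1"
    and res1: "\<And>m x y. residual m (zero_series.mu w1 m) (grid u\<^sub>1 m) x y = 0"
    and cont1: "continuous_on vicsek u\<^sub>1" and nz: "u\<^sub>1 (0, 0) \<noteq> 0"
    using zero_series_eigenfunction_decimation [OF assms(1)] by blast
  obtain w2 where w2: "zero_series w2"
    and res2: "\<And>m x y. residual m (zero_series.mu w2 m) (grid u\<^sub>2 m) x y = 0"
    and cont2: "continuous_on vicsek u\<^sub>2"
    using zero_series_eigenfunction_decimation [OF assms(2)] by blast
  have diag: "u\<^sub>1 (t, t) = u\<^sub>2 (t, t)" if "0 \<le> t" "t \<le> 1" for t
    using assms(3) that by (force simp: closed_segment_def)
  have mu: "zero_series.mu w1 m = zero_series.mu w2 m" for m
  proof -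
    \<comment> \<open>This vertex is on the diagonal, and its value is \<open>mu m - 3\<close> times
      the nonzero value at the origin.\<close>
    have "grid u\<^sub>1 m 1 1 = grid u\<^sub>2 m 1 1" by (simp add: grid_def diag)
    thus ?thesis
      using zero_series.grid_corner(3) [OF w1 res1] zero_series.grid_corner(3) [OF w2 res2]
        diag [of 0] nz by simp
  qed
  \<comment> \<open>With \<open>mu\<close> equal on all levels, the difference solves the same
    vertex equations and vanishes at the origin.\<close>
  have "u\<^sub>1 p - u\<^sub>2 p = 0"
  proof (rule zero_series.zero_on_vicsek [OF w1 _ _ _ p])
    show "residual m (zero_series.mu w1 m) (grid (\<lambda>x. u\<^sub>1 x - u\<^sub>2 x) m) x y = 0" for m x y
      unfolding residual_diff using res1 res2 mu by simp
    show "continuous_on vicsek (\<lambda>x. u\<^sub>1 x - u\<^sub>2 x)"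
      by (intro continuous_intros cont1 cont2)
    show "u\<^sub>1 (0, 0) - u\<^sub>2 (0, 0) = 0" using diag [of 0] by simp
  qed
  thus "u\<^sub>1 p = u\<^sub>2 p" by simp
qed

end
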